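(* There exist a constant $\alpha>0$ and an integer $n_0$ such that for every integer $n\ge n_0$ and every positive integer $b\le\alpha\frac{n}{\ln n}$, Walker has a winning strategy in the $(2:b)$ Walker--Breaker Hamilton Cycle game played on $E(K_n)$; that is, Walker has a strategy guaranteeing that, against any play of Breaker, she claims all the edges of some Hamilton cycle of $K_n$ by the end of the game.
   Context: The $(2:b)$ Walker--Breaker game on $E(K_n)$ (the edge set of the complete graph on $n$ vertices) is played by two players, Walker and Breaker, who alternately move, until all edges of $K_n$ are claimed. In each of his moves Breaker claims $b$ edges not yet claimed by either player (or all remaining unclaimed edges if there are fewer than $b$). Walker must choose her edges according to a walk: at her first move she chooses any vertex of $K_n$ as her starting position; each of her moves consists of two successive steps, where in one step, being positioned at a vertex $v$, she chooses an edge $vw$ not previously claimed by Breaker (it may be unclaimed or already claimed by Walker herself), claims it if it was unclaimed, and $w$ becomes her current position. Each subsequent step starts at her current position, also from one move to the next. In the Hamilton Cycle game the winning sets are the edge sets of Hamilton cycles of $K_n$. Walker wins if by the end of the game she has claimed all edges of some winning set; otherwise Breaker wins. Convention for this result: Breaker is the first player, i.e. each round consists of a move of Breaker followed by a move of Walker (so Walker chooses her starting position after Breaker's first move). *)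

theory Defs
  imports Complex_Main "HOL-Library.Ramsey"
begin

type_synonym edge = "nat set"

definition complete_edges :: "nat \<Rightarrow> edge set" where
  "complete_edges n = [{..<n}]\<^bsup>2\<^esup>"

definition cycle_edges :: "nat list \<Rightarrow> edge set" where
  "cycle_edges vs = {{vs ! i, vs ! ((i + 1) mod length vs)} |i. i < length vs}"

definition hamilton_cycles :: "nat \<Rightarrow> edge set set" where
  "hamilton_cycles n =
     {cycle_edges vs |vs. 3 \<le> length vs \<and> distinct vs \<and> set vs = {..<n}}"


datatype player = Walker | Breaker

text \<open>The position is \<^term>\<open>None\<close> until Walker has chosen her starting vertex.\<close>

record game_state =
  walker_edges :: "edge set"
  breaker_edges :: "edge set"
  position :: "nat option"

definition initial_state :: game_state where
  "initial_state = \<lparr>walker_edges = {}, breaker_edges = {}, position = None\<rparr>"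

definition unclaimed :: "nat \<Rightarrow> game_state \<Rightarrow> edge set" where
  "unclaimed n s = complete_edges n - (walker_edges s \<union> breaker_edges s)"

definition game_over :: "nat \<Rightarrow> game_state \<Rightarrow> bool" where
  "game_over n s \<longleftrightarrow> unclaimed n s = {}"

definition legal_breaker_move :: "nat \<Rightarrow> nat \<Rightarrow> game_state \<Rightarrow> edge set \<Rightarrow> bool" where
  "legal_breaker_move n b s F \<longleftrightarrow>
     F \<subseteq> unclaimed n s \<and> card F = min b (card (unclaimed n s))"

definition apply_breaker_move :: "edge set \<Rightarrow> game_state \<Rightarrow> game_state" where
  "apply_breaker_move F s = s\<lparr>breaker_edges := breaker_edges s \<union> F\<rparr>"

text \<open>
  A move of Walker is recorded as the triple of vertices \<open>(u, v, w)\<close> visited by its two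
  steps \<open>u \<rightarrow> v \<rightarrow> w\<close>. In her first move \<open>u\<close> is the chosen starting vertex; afterwards
  \<open>u\<close> is forced to be her current position. She may reuse her own edges, in particular
  \<open>w = u\<close> is allowed.
\<close>

type_synonym walker_move = "nat \<times> nat \<times> nat"

definition walkable :: "nat \<Rightarrow> game_state \<Rightarrow> edge \<Rightarrow> bool" where
  "walkable n s e \<longleftrightarrow> e \<in> complete_edges n \<and> e \<notin> breaker_edges s"

fun legal_walker_move :: "nat \<Rightarrow> game_state \<Rightarrow> walker_move \<Rightarrow> bool" where
  "legal_walker_move n s (u, v, w) \<longleftrightarrow>
     (case position s of None \<Rightarrow> u < n | Some p \<Rightarrow> u = p) \<and>
     walkable n s {u, v} \<and> walkable n s {v, w}"

fun apply_walker_move :: "walker_move \<Rightarrow> game_state \<Rightarrow> game_state" where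
  "apply_walker_move (u, v, w) s =
     s\<lparr>walker_edges := walker_edges s \<union> {{u, v}, {v, w}}, position := Some w\<rparr>"

text \<open>
  A strategy maps the list of all previous moves of Breaker, in chronological order, to
  Walker's next move. Walker's own previous moves are determined by this list and the
  strategy itself.
\<close>

type_synonym walker_strategy = "edge set list \<Rightarrow> walker_move"

text \<open>
  \<open>play n b \<sigma> p h s\<close>: in the \<open>(2:b)\<close> game on the complete graph on \<open>n\<close> vertices, with
  Breaker moving first and Walker following \<open>\<sigma>\<close>, the state \<open>s\<close> with player \<open>p\<close> next in
  turn can be reached, where \<open>h\<close> lists the moves Breaker has made so far.
\<close>

inductive play ::
    "nat \<Rightarrow> nat \<Rightarrow> walker_strategy \<Rightarrow> player \<Rightarrow> edge set list \<Rightarrow> game_state \<Rightarrow> bool"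
  for n b :: nat and \<sigma> :: walker_strategy where
  start: "play n b \<sigma> Breaker [] initial_state"
| breaker: "\<lbrakk>play n b \<sigma> Breaker h s; \<not> game_over n s; legal_breaker_move n b s F\<rbrakk>
    \<Longrightarrow> play n b \<sigma> Walker (h @ [F]) (apply_breaker_move F s)"
| walker: "\<lbrakk>play n b \<sigma> Walker h s; \<not> game_over n s; legal_walker_move n s (\<sigma> h)\<rbrakk>
    \<Longrightarrow> play n b \<sigma> Breaker h (apply_walker_move (\<sigma> h) s)"

text \<open>
  For \<open>b \<ge> 1\<close> every play ends after finitely many moves, since each move of Breaker uses
  up an unclaimed edge; and Breaker always has a legal move while the game is not over.
  Hence a strategy wins iff it never fails to supply a legal move and every final state
  reached is won.
\<close>

definition walker_winning_strategy ::
    "nat \<Rightarrow> nat \<Rightarrow> edge set set \<Rightarrow> walker_strategy \<Rightarrow> bool" where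
  "walker_winning_strategy n b \<F> \<sigma> \<longleftrightarrow>
     (\<forall>h s. play n b \<sigma> Walker h s \<and> \<not> game_over n s \<longrightarrow> legal_walker_move n s (\<sigma> h)) \<and>
     (\<forall>p h s. play n b \<sigma> p h s \<and> game_over n s \<longrightarrow> (\<exists>H\<in>\<F>. H \<subseteq> walker_edges s))"

end

theory Submission
  imports Defs
begin

text \<open>
Walker builds her Hamilton cycle in \<open>O(n)\<close> rounds, long before Breaker has claimed a constant
proportion of the edges: by then Breaker holds only \<open>O(n b)\<close> edges, which is a small multiple of
\<open>n\<^sup>2 / ln n\<close>. The play splits into two phases, and in both a single move of Walker does useful work
at vertices of her choice, because her two steps \<open>p \<rightarrow> w \<rightarrow> v\<close> lead from one vertex of low Breaker
degree to any other one through almost any \<open>w\<close>.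

In the first phase every vertex \<open>v\<close> collects a list \<open>g v\<close> of 30 neighbours. In each round Walker
ends at the unfinished vertex \<open>v\<close> that is most endangered and lets the intermediate vertex \<open>w\<close> of
her move join the list of \<open>v\<close>. The danger grows by a factor \<open>1 + 1 / (8 b)\<close> with each Breaker edge
at \<open>v\<close> and halves with each new neighbour; the total danger stays at most \<open>n + 1\<close>, so the Breaker
degree of an unfinished vertex stays at most \<open>n / 40\<close> (\<open>danger_after_breaker\<close>,
\<open>danger_after_walker\<close>, \<open>danger_bounds_degree\<close>). Hence at least \<open>9 n / 10\<close> vertices can serve as \<open>w\<close>.
If \<open>w\<close> were random among them, the resulting graph would be an expander by a union bound; the
potential \<open>trap_potential\<close> bounds the expected number of violations in that experiment, and the
method of conditional expectations replaces chance by a choice of \<open>w\<close> that does not increase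
it (\<open>trap_potential_choice\<close>, \<open>trap_potential_initial\<close>, \<open>trap_potential_expander\<close>).

In the second phase Walker's graph is an expander in which sets of up to about \<open>n / 6\<close> vertices
expand, in particular a connected graph. By Posa's rotation argument (\<open>posa_rotation\<close>) the longest
paths obtained from a given one by rotations have more than \<open>n / 6\<close> different end vertices \<open>x\<close>, and
after fixing such an \<open>x\<close> there are more than \<open>n / 6\<close> possibilities for the other end vertex \<open>y\<close>.
All but few vertices have low Breaker degree, so \<open>x\<close> and \<open>y\<close> can be chosen such that the move
\<open>p \<rightarrow> x \<rightarrow> y\<close> is legal. It closes a longest path to a cycle, which is either a Hamilton cycle or, by
connectedness, yields a longer path. So at most \<open>n\<close> such moves suffice. Afterwards Walker walks
back and forth on one of her edges until the game ends.
\<close>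

section \<open>Strategies from invariants\<close>

text \<open>
A strategy sees only Breaker's moves, but these determine the state, because Walker's own moves can
be replayed. So it suffices to be able to preserve an invariant, with one version \<open>I\<close> for the states
in which Breaker moves and one version \<open>J\<close> for those in which Walker moves. Auxiliary data such as
round counters can be hidden behind existential quantifiers in the invariant.
\<close>
lemma winning_strategy_from_invariant:
  assumes init: "I initial_state"
    and breaker_step: "\<And>s F. I s \<Longrightarrow> \<not> game_over n s \<Longrightarrow> legal_breaker_move n b s F
                         \<Longrightarrow> J (apply_breaker_move F s)"
    and walker_step: "\<And>s. J s \<Longrightarrow> \<not> game_over n s
                         \<Longrightarrow> \<exists>m. legal_walker_move n s m \<and> I (apply_walker_move m s)"
    and I_won: "\<And>s. I s \<Longrightarrow> game_over n s \<Longrightarrow> \<exists>H\<in>\<F>. H \<subseteq> walker_edges s"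
    and J_won: "\<And>s. J s \<Longrightarrow> game_over n s \<Longrightarrow> \<exists>H\<in>\<F>. H \<subseteq> walker_edges s"
  shows "\<exists>\<sigma> :: walker_strategy. walker_winning_strategy n b \<F> \<sigma>"
proof -
  define move where
    "move s = (SOME m. legal_walker_move n s m \<and> I (apply_walker_move m s))" for s
  define play_round where
    "play_round s F = apply_walker_move (move (apply_breaker_move F s)) (apply_breaker_move F s)" for s F
  define \<sigma> where
    "\<sigma> h = move (apply_breaker_move (last h) (foldl play_round initial_state (butlast h)))" for h
  have move: "legal_walker_move n s (move s) \<and> I (apply_walker_move (move s) s)"
    if "J s" "\<not> game_over n s" for s
    unfolding move_def by (rule someI_ex) (rule walker_step[OF that])
  have inv: "case p of Breaker \<Rightarrow> s = foldl play_round initial_state h \<and> I s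
      | Walker \<Rightarrow> (\<exists>h' F. h = h' @ [F] \<and>
            s = apply_breaker_move F (foldl play_round initial_state h')) \<and> J s"
    if "play n b \<sigma> p h s" for p h s
    using that
  proof (induction rule: play.induct)
    case start
    show ?case using init by simp
  next
    case (breaker h s F)
    then show ?case using breaker_step by auto
  next
    case (walker h s)
    then show ?case using move by (auto simp: \<sigma>_def play_round_def)
  qed
  have "walker_winning_strategy n b \<F> \<sigma>"
    unfolding walker_winning_strategy_def
  proof (intro conjI allI impI)
    fix h s assume *: "play n b \<sigma> Walker h s \<and> \<not> game_over n s"
    then show "legal_walker_move n s (\<sigma> h)"
      using inv[of Walker h s] move by (auto simp: \<sigma>_def)
  next
    fix p h s assume *: "play n b \<sigma> p h s \<and> game_over n s"
    then show "\<exists>H\<in>\<F>. H \<subseteq> walker_edges s"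
      using inv[of p h s] I_won J_won by (cases p) auto
  qed
  then show ?thesis by blast
qed

section \<open>Paths and Posa rotations\<close>

fun path_edges :: "'a list \<Rightarrow> 'a set set" where
  "path_edges (x # y # zs) = insert {x, y} (path_edges (y # zs))"
| "path_edges _ = {}"

lemma path_edges_Cons: "ys \<noteq> [] \<Longrightarrow> path_edges (x # ys) = insert {x, hd ys} (path_edges ys)"
  by (cases ys) auto

lemma path_edges_append:
  "path_edges (xs @ a # ys) = path_edges (xs @ [a]) \<union> path_edges (a # ys)"
  by (induction xs rule: path_edges.induct) (auto simp: path_edges_Cons)

lemma path_edges_rev: "path_edges (rev xs) = path_edges xs"
proof (induction xs rule: path_edges.induct)
  case (1 x y zs)
  have "path_edges (rev (x # y # zs)) = path_edges (rev zs @ [y]) \<union> path_edges [y, x]"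
    using path_edges_append[of "rev zs" y "[x]"] by simp
  then show ?case using 1 by (auto simp: insert_commute)
qed auto

lemma path_edges_subset: "e \<in> path_edges xs \<Longrightarrow> e \<subseteq> set xs"
  by (induction xs rule: path_edges.induct) auto

lemma path_edges_neighbour_hd:
  assumes "distinct (x # xs)" "{x, z} \<in> path_edges (x # xs)"
  shows "z = hd xs"
proof (cases xs)
  case (Cons y ys)
  have "{x, z} \<notin> path_edges xs" using path_edges_subset[of "{x,z}" xs] assms(1) by auto
  then show ?thesis using assms Cons by (auto simp: doubleton_eq_iff)
qed (use assms in auto)

lemma path_neighbours_le_2:
  assumes "distinct P" "r \<in> set P"
  shows "finite {z. {r, z} \<in> path_edges P}" "card {z. {r, z} \<in> path_edges P} \<le> 2"
proof -
  obtain us vs where P: "P = us @ r # vs" using assms(2) by (meson split_list)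
  have "z \<in> {last us, hd vs}" if "{r, z} \<in> path_edges P" for z
  proof -
    have "{r, z} \<in> path_edges (r # rev us) \<or> {r, z} \<in> path_edges (r # vs)"
      using that path_edges_append[of us r vs] path_edges_rev[of "us @ [r]"] by (auto simp: P)
    moreover have "distinct (r # rev us)" "distinct (r # vs)" using assms(1) by (auto simp: P)
    ultimately show ?thesis
      using path_edges_neighbour_hd[of r "rev us" z] path_edges_neighbour_hd[of r vs z]
      by (auto simp: hd_rev)
  qed
  then have sub: "{z. {r, z} \<in> path_edges P} \<subseteq> {last us, hd vs}" by blast
  show "finite {z. {r, z} \<in> path_edges P}" using sub by (rule finite_subset) simp
  have "card {z. {r, z} \<in> path_edges P} \<le> card {last us, hd vs}"
    using sub by (intro card_mono) auto
  also have "\<dots> \<le> 2" by (simp add: card_insert_if)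
  finally show "card {z. {r, z} \<in> path_edges P} \<le> 2" .
qed

definition path_in :: "'a set \<Rightarrow> 'a set set \<Rightarrow> 'a list \<Rightarrow> bool" where
  "path_in V E P \<longleftrightarrow> P \<noteq> [] \<and> distinct P \<and> set P \<subseteq> V \<and> path_edges P \<subseteq> E"

text \<open>
A rotation keeps the first vertex: an edge from the last vertex of the path back to an earlier vertex
\<open>a\<close> replaces the path edge that leaves \<open>a\<close>, whose other end becomes the new last vertex.
\<close>
inductive rotation :: "'a set set \<Rightarrow> 'a list \<Rightarrow> 'a list \<Rightarrow> bool" for E P where
  unrotated: "rotation E P P"
| rotate: "rotation E P (xs @ a # ys) \<Longrightarrow> ys \<noteq> [] \<Longrightarrow> {last ys, a} \<in> E \<Longrightarrow>
    rotation E P (xs @ a # rev ys)"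

lemma path_edges_pivot:
  "ys \<noteq> [] \<Longrightarrow> path_edges (xs @ a # ys) = path_edges (xs @ [a]) \<union> {{a, hd ys}} \<union> path_edges ys"
  by (subst path_edges_append) (auto simp: path_edges_Cons)

lemma path_edges_rotated:
  "ys \<noteq> [] \<Longrightarrow>
    path_edges (xs @ a # rev ys) = path_edges (xs @ [a]) \<union> {{a, last ys}} \<union> path_edges ys"
  by (subst path_edges_pivot) (auto simp: path_edges_rev hd_rev)

lemma rotation_path:
  assumes "rotation E P Q" "path_in V E P"
  shows "path_in V E Q" "set Q = set P" "length Q = length P" "hd Q = hd P"
proof -
  have "path_in V E Q \<and> set Q = set P \<and> length Q = length P \<and> hd Q = hd P"
    using assms
  proof (induction rule: rotation.induct)
    case (rotate xs a ys)
    then have IH: "path_in V E (xs @ a # ys)" "set (xs @ a # ys) = set P"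
        "length (xs @ a # ys) = length P" "hd (xs @ a # ys) = hd P"
      by blast+
    have "path_edges (xs @ a # rev ys) \<subseteq> E"
      using IH(1) rotate.hyps
      unfolding path_in_def path_edges_rotated[OF rotate.hyps(2)] path_edges_pivot[OF rotate.hyps(2)]
      by (auto simp: insert_commute)
    then have "path_in V E (xs @ a # rev ys)" using IH(1) by (simp add: path_in_def)
    then show ?case using IH by (cases xs) simp_all
  qed auto
  then show "path_in V E Q" "set Q = set P" "length Q = length P" "hd Q = hd P" by auto
qed

definition rotation_ends :: "'a set set \<Rightarrow> 'a list \<Rightarrow> 'a set" where
  "rotation_ends E P = {last Q |Q. rotation E P Q}"

text \<open>
The path edge removed by a rotation at \<open>a\<close> ends in the new end vertex. So if neither \<open>y\<close> nor any of
its neighbours on the original path ever becomes an end vertex, then no rotation removes an edge at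
\<open>y\<close>; and none adds one, since an added edge joins the pivot \<open>a\<close> to an end vertex, and
\<open>a = y\<close> is excluded by the first observation.
\<close>
lemma rotation_keeps_neighbours:
  assumes "rotation E P Q" "y \<notin> rotation_ends E P"
    "\<And>r. r \<in> rotation_ends E P \<Longrightarrow> {y, r} \<notin> path_edges P"
  shows "{y, z} \<in> path_edges Q \<longleftrightarrow> {y, z} \<in> path_edges P"
  using assms
proof (induction arbitrary: z rule: rotation.induct)
  case (rotate xs a ys)
  have IH: "{y, z} \<in> path_edges (xs @ a # ys) \<longleftrightarrow> {y, z} \<in> path_edges P" for z
    using rotate by blast
  have l: "last ys \<in> rotation_ends E P"
    unfolding rotation_ends_def mem_Collect_eq
    by (rule exI[of _ "xs @ a # ys"]) (use rotate.hyps in simp)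
  have h: "hd ys \<in> rotation_ends E P"
    unfolding rotation_ends_def mem_Collect_eq
    by (rule exI[of _ "xs @ a # rev ys"])
      (use rotation.rotate[OF rotate.hyps] rotate.hyps(2) in \<open>simp add: last_rev\<close>)
  show ?case
  proof (cases "y = a")
    case True
    then have "{y, hd ys} \<in> path_edges (xs @ a # ys)"
      using rotate.hyps(2) by (auto simp: path_edges_pivot)
    then show ?thesis using IH h rotate.prems by blast
  next
    case False
    have "y \<noteq> last ys" "y \<noteq> hd ys" using l h rotate.prems by auto
    with False have "{y, z} \<in> path_edges (xs @ a # rev ys) \<longleftrightarrow> {y, z} \<in> path_edges (xs @ a # ys)"
      unfolding path_edges_rotated[OF rotate.hyps(2)] path_edges_pivot[OF rotate.hyps(2)]
      by (auto simp: doubleton_eq_iff)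
    then show ?thesis using IH by simp
  qed
qed auto

section \<open>Expanders\<close>

definition neighbours :: "'a set set \<Rightarrow> 'a set \<Rightarrow> 'a set" where
  "neighbours E A = {w. \<exists>v\<in>A. {v, w} \<in> E}"

text \<open>
The strict inequality gives a set \<open>A\<close> more than \<open>2 |A|\<close> neighbours outside of \<open>A\<close>, just enough to
contradict the bound of two path neighbours per vertex in Posa's argument.
\<close>
definition expander :: "'a set \<Rightarrow> nat \<Rightarrow> 'a set set \<Rightarrow> bool" where
  "expander V k E \<longleftrightarrow>
     (\<forall>A\<subseteq>V. A \<noteq> {} \<and> card A \<le> k \<longrightarrow> 3 * card A < card (A \<union> neighbours E A))"

definition longest_path :: "'a set \<Rightarrow> 'a set set \<Rightarrow> 'a list \<Rightarrow> bool" where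
  "longest_path V E P \<longleftrightarrow> path_in V E P \<and> (\<forall>Q. path_in V E Q \<longrightarrow> length Q \<le> length P)"

lemma longest_path_neighbour_of_end:
  assumes "longest_path V E P" "{last P, y} \<in> E" "y \<in> V"
  shows "y \<in> set P"
proof (rule ccontr)
  assume y: "y \<notin> set P"
  have P: "path_in V E P" using assms(1) by (simp add: longest_path_def)
  then have "P = butlast P @ [last P]" by (simp add: path_in_def)
  then have "path_edges (P @ [y]) = path_edges P \<union> {{last P, y}}"
    using path_edges_append[of "butlast P" "last P" "[y]"]
    by (metis Un_insert_right append.assoc append_Cons append_Nil path_edges.simps(1,3))
  then have "path_in V E (P @ [y])" using P y assms by (auto simp: path_in_def)
  then show False using assms(1) by (force simp: longest_path_def)
qed

text \<open>
Posa's lemma. A neighbour \<open>y\<close> of an end vertex \<open>last Q\<close> lies on \<open>Q\<close> by maximality, and rotating \<open>Q\<close> at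
\<open>y\<close> makes the successor of \<open>y\<close> an end vertex. Thus, unless \<open>y\<close> is itself an end vertex, it has an
end vertex as a neighbour on the original path \<open>P\<close>: otherwise its path neighbours would never have
changed. Since each end vertex has at most two neighbours on \<open>P\<close>, the set of end vertices
does not expand, and so it must be large.
\<close>
lemma posa_rotation:
  assumes P: "longest_path V E P" and V: "finite V" "\<Union>E \<subseteq> V" and E: "expander V k E"
  shows "k < card (rotation_ends E P)"
proof (rule ccontr)
  let ?R = "rotation_ends E P"
  assume "\<not> k < card ?R"
  have path: "path_in V E P" using P by (simp add: longest_path_def)
  have R_sub: "?R \<subseteq> set P"
  proof
    fix x assume "x \<in> ?R"
    then obtain Q where "rotation E P Q" "x = last Q" by (auto simp: rotation_ends_def)
    then show "x \<in> set P" using rotation_path[OF _ path, of Q] by (auto simp: path_in_def)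
  qed
  have fin: "finite ?R" using R_sub by (rule finite_subset) simp
  have "last P \<in> ?R" by (auto simp: rotation_ends_def intro: rotation.unrotated)
  define N where "N = (\<Union>r\<in>?R. {z. {r, z} \<in> path_edges P})"
  have "neighbours E ?R \<subseteq> ?R \<union> N"
  proof
    fix y assume "y \<in> neighbours E ?R"
    then obtain Q where Q: "rotation E P Q" "{last Q, y} \<in> E"
      by (auto simp: neighbours_def rotation_ends_def)
    have "longest_path V E Q"
      using P rotation_path[OF Q(1) path] by (auto simp: longest_path_def)
    then have y: "y \<in> set Q"
      using longest_path_neighbour_of_end Q(2) V by (metis UnionI insertCI subsetD)
    show "y \<in> ?R \<union> N"
    proof (rule ccontr)
      assume *: "y \<notin> ?R \<union> N"
      then have no: "\<And>r. r \<in> ?R \<Longrightarrow> {y, r} \<notin> path_edges P"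
        by (auto simp: N_def insert_commute)
      obtain us vs where dec: "Q = us @ y # vs" using y by (meson split_list)
      have "vs \<noteq> []" using * Q(1) dec by (auto simp: rotation_ends_def)
      have "rotation E P (us @ y # rev vs)"
        using rotation.rotate[of E P us y vs] Q dec \<open>vs \<noteq> []\<close> by simp
      then have "hd vs \<in> ?R"
        unfolding rotation_ends_def mem_Collect_eq
        by (intro exI[of _ "us @ y # rev vs"]) (use \<open>vs \<noteq> []\<close> in \<open>simp add: last_rev\<close>)
      moreover have "{y, hd vs} \<in> path_edges Q"
        using \<open>vs \<noteq> []\<close> by (auto simp: dec path_edges_pivot)
      ultimately show False
        using rotation_keeps_neighbours[OF Q(1), of y "hd vs"] * no by auto
    qed
  qed
  then have "?R \<union> neighbours E ?R \<subseteq> ?R \<union> N" by blast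
  moreover have "finite N" using fin R_sub path path_neighbours_le_2(1)[of P]
    by (auto simp: N_def path_in_def)
  ultimately have "card (?R \<union> neighbours E ?R) \<le> card (?R \<union> N)"
    using fin by (intro card_mono) auto
  also have "\<dots> \<le> card ?R + card N" by (rule card_Un_le)
  also have "card N \<le> (\<Sum>r\<in>?R. card {z. {r, z} \<in> path_edges P})"
    unfolding N_def by (rule card_UN_le[OF fin])
  also have "\<dots> \<le> (\<Sum>r\<in>?R. 2)"
    using R_sub path path_neighbours_le_2(2)[of P] by (intro sum_mono) (auto simp: path_in_def)
  finally have "card (?R \<union> neighbours E ?R) \<le> 3 * card ?R" by simp
  moreover have "?R \<subseteq> V" using R_sub path by (auto simp: path_in_def)
  ultimately show False
    using E \<open>\<not> k < card ?R\<close> \<open>last P \<in> ?R\<close> unfolding expander_def by (metis empty_iff leD not_less)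
qed

text \<open>
Either \<open>U\<close> or its complement has at most \<open>|V| / 2 \<le> 3 k\<close> elements. If no edge left it, a subset of size
\<open>k\<close> (or the whole set, if it is smaller) would have to expand beyond it.
\<close>
lemma expander_connected:
  assumes E: "expander V k E" and V: "finite V" "\<Union>E \<subseteq> V" "card V \<le> 6 * k"
    and U: "U \<subseteq> V" "U \<noteq> {}" "U \<noteq> V"
  shows "\<exists>u\<in>V - U. \<exists>c\<in>U. {u, c} \<in> E"
proof (rule ccontr)
  assume no: "\<not> ?thesis"
  have small: False if X: "X \<subseteq> V" "X \<noteq> {}" "2 * card X \<le> card V" "neighbours E X \<subseteq> X" for X
  proof -
    have finX: "finite X" using X V finite_subset by blast
    obtain A where A: "A \<subseteq> X" "card A = min k (card X)"
      by (metis obtain_subset_with_card_n min.cobounded2)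
    have "card A \<noteq> 0"
    proof
      assume "card A = 0"
      then have "k = 0 \<or> card X = 0" using A by (auto simp: min_def split: if_splits)
      then have "card V = 0" using finX X V by auto
      then show False using V X by auto
    qed
    then have "A \<noteq> {}" by auto
    then have "3 * card A < card (A \<union> neighbours E A)"
      using E A X unfolding expander_def by (metis min.cobounded1 subset_trans)
    also have "\<dots> \<le> card X"
      using A X finX by (intro card_mono) (auto simp: neighbours_def)
    finally show False using A X V by (auto simp: min_def split: if_splits)
  qed
  have "neighbours E U \<subseteq> U" using no V by (auto simp: neighbours_def insert_commute)
  moreover have "neighbours E (V - U) \<subseteq> V - U" using no V by (auto simp: neighbours_def)
  moreover have "2 * card U \<le> card V \<or> 2 * card (V - U) \<le> card V"
    using V U by (auto simp: card_Diff_subset finite_subset)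
  ultimately show False using small[of U] small[of "V - U"] U by blast
qed

lemma longest_path_exists:
  assumes "finite V" "path_in V E P0"
  shows "\<exists>P. longest_path V E P \<and> length P0 \<le> length P"
proof -
  have len: "length Q \<le> card V" if "path_in V E Q" for Q
    using that assms(1) by (metis card_mono distinct_card path_in_def)
  obtain P where "path_in V E P" "\<forall>Q. path_in V E Q \<longrightarrow> length Q \<le> length P"
    using ex_has_greatest_nat[of "path_in V E" P0 length "card V + 1"] assms len
    by (auto simp: less_Suc_eq_le)
  then show ?thesis using assms(2) by (auto simp: longest_path_def)
qed

text \<open>
Cut the cycle open at the vertex \<open>c\<close> and put the outside vertex \<open>u\<close> in front.
\<close>
lemma rotated_cycle_extends:
  assumes P: "path_in V E P" "{last P, hd P} \<in> E" and c: "c \<in> set P" and u: "u \<in> V - set P" "{u, c} \<in> E"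
  shows "\<exists>Q. path_in V E Q \<and> length Q = Suc (length P)"
proof -
  obtain us vs where dec: "P = us @ c # vs" using c by (meson split_list)
  have "path_edges (c # vs @ us) \<subseteq> E"
  proof (cases "us = []")
    case False
    have "path_edges (c # vs @ us) = path_edges (butlast (c # vs) @ last (c # vs) # us)"
      using append_butlast_last_id[of "c # vs"] by (metis append.assoc append_Cons append_Nil list.distinct(1))
    also have "\<dots> = path_edges (c # vs) \<union> path_edges (last (c # vs) # us)"
      by (subst path_edges_append) simp
    also have "\<dots> = path_edges (c # vs) \<union> {{last P, hd P}} \<union> path_edges us"
      using False by (simp add: path_edges_Cons dec)
    also have "path_edges us \<subseteq> path_edges P"
    proof -
      have "path_edges us \<subseteq> path_edges (us @ [c])"
        using path_edges_append[of "butlast us" "last us" "[c]"] False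
        by (metis Un_upper1 append.assoc append_Cons append_Nil append_butlast_last_id)
      then show ?thesis using path_edges_append[of us c vs] by (auto simp: dec)
    qed
    moreover have "path_edges (c # vs) \<subseteq> path_edges P"
      using path_edges_append[of us c vs] by (auto simp: dec)
    ultimately show ?thesis using P by (auto simp: path_in_def)
  qed (use P dec in \<open>auto simp: path_in_def\<close>)
  then have "path_in V E (u # c # vs @ us)"
    using P u by (auto simp: path_in_def dec)
  then show ?thesis by (intro exI[of _ "u # c # vs @ us"]) (auto simp: dec)
qed

lemma path_edges_nth: "Suc i < length xs \<Longrightarrow> {xs ! i, xs ! Suc i} \<in> path_edges xs"
proof (induction xs arbitrary: i rule: path_edges.induct)
  case (1 x y zs)
  then show ?case by (cases i) auto
qed auto

lemma cycle_edges_subset: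
  assumes "vs \<noteq> []" "path_edges vs \<subseteq> E" "{last vs, hd vs} \<in> E"
  shows "cycle_edges vs \<subseteq> E"
proof
  fix e assume "e \<in> cycle_edges vs"
  then obtain i where i: "i < length vs" "e = {vs ! i, vs ! ((i + 1) mod length vs)}"
    by (auto simp: cycle_edges_def)
  show "e \<in> E"
  proof (cases "Suc i < length vs")
    case True
    then show ?thesis using i path_edges_nth[OF True] assms by auto
  next
    case False
    then have "Suc i = length vs" using i by simp
    then have "i = length vs - 1" "(i + 1) mod length vs = 0" by simp_all
    then have "e = {last vs, hd vs}"
      using i(2) assms(1) by (simp add: last_conv_nth hd_conv_nth)
    then show ?thesis using assms by simp
  qed
qed

lemma expander_mono:
  assumes E: "expander V k E" and E': "E \<subseteq> E'" "finite V" "\<Union>E' \<subseteq> V"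
  shows "expander V k E'"
  unfolding expander_def
proof (intro allI impI)
  fix A assume A: "A \<subseteq> V" "A \<noteq> {} \<and> card A \<le> k"
  have sub: "A \<union> neighbours E A \<subseteq> A \<union> neighbours E' A" using E' by (auto simp: neighbours_def)
  have "A \<union> neighbours E' A \<subseteq> V" using E' A by (auto simp: neighbours_def)
  then have "finite (A \<union> neighbours E' A)" using E'(2) by (rule finite_subset)
  then have "card (A \<union> neighbours E A) \<le> card (A \<union> neighbours E' A)" using sub by (rule card_mono)
  moreover have "3 * card A < card (A \<union> neighbours E A)" using E A unfolding expander_def by blast
  ultimately show "3 * card A < card (A \<union> neighbours E' A)" by linarith
qed

section \<open>A derandomised choice of neighbours\<close>

text \<open>
The pairs \<open>(A, S)\<close> are the possible violations of expansion: a set \<open>A\<close> of at most \<open>k\<close> vertices with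
\<open>3 k \<le> n\<close> fails to expand iff \<open>A\<close> and all its neighbours fit into some \<open>S\<close> of three times its size.
\<close>
definition tight_covers :: "nat \<Rightarrow> nat \<Rightarrow> (nat set \<times> nat set) set" where
  "tight_covers n k =
     {(A, S). A \<subseteq> S \<and> S \<subseteq> {..<n} \<and> card S = 3 * card A \<and> 1 \<le> card A \<and> card A \<le> k}"

lemma finite_tight_covers: "finite (tight_covers n k)"
  by (rule finite_subset[of _ "Pow {..<n} \<times> Pow {..<n}"]) (auto simp: tight_covers_def)

text \<open>
An upper bound for the probability that a vertex chosen uniformly from at least \<open>9 n / 10\<close> candidates
falls into \<open>S\<close>.
\<close>
definition trap_ratio :: "nat \<Rightarrow> nat set \<Rightarrow> real" where
  "trap_ratio n S = 10 * real (card S) / (9 * real n)"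

text \<open>
If \<open>xs\<close> are the neighbours selected for a vertex so far and \<open>D\<close> is their final number, this bounds
the probability that all of them end up in \<open>S\<close> when the remaining ones are chosen at random.
\<close>
definition trap_factor :: "nat \<Rightarrow> nat \<Rightarrow> nat set \<Rightarrow> nat list \<Rightarrow> real" where
  "trap_factor n D S xs = (if set xs \<subseteq> S then trap_ratio n S ^ (D - length xs) else 0)"

text \<open>
A bound for the expected number of pairs \<open>(A, S)\<close> that violate expansion in the end, given the
selections in \<open>g\<close>.
\<close>
definition trap_potential :: "nat \<Rightarrow> nat \<Rightarrow> nat \<Rightarrow> (nat \<Rightarrow> nat list) \<Rightarrow> real" where
  "trap_potential n k D g = (\<Sum>(A, S)\<in>tight_covers n k. \<Prod>v\<in>A. trap_factor n D S (g v))"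

lemma trap_factor_nonneg: "0 \<le> trap_factor n D S xs"
  by (simp add: trap_factor_def trap_ratio_def)

lemma trap_factor_average:
  assumes "finite C" "9 * n \<le> 10 * card C" "0 < n" "length xs < D" "finite S"
  shows "(\<Sum>w\<in>C. trap_factor n D S (w # xs)) \<le> real (card C) * trap_factor n D S xs"
proof (cases "set xs \<subseteq> S")
  case True
  let ?r = "trap_ratio n S"
  have "D - length xs = Suc (D - Suc (length xs))" using assms by simp
  then have pw: "?r ^ (D - length xs) = ?r * ?r ^ (D - Suc (length xs))" by simp
  have "(\<Sum>w\<in>C. trap_factor n D S (w # xs))
      = (\<Sum>w\<in>C. if w \<in> S then ?r ^ (D - Suc (length xs)) else 0)"
    using True by (auto simp: trap_factor_def intro!: sum.cong)
  also have "\<dots> = (\<Sum>w\<in>C \<inter> S. ?r ^ (D - Suc (length xs)))"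
    by (rule sum.inter_restrict[symmetric]) (use assms in simp)
  also have "\<dots> = real (card (C \<inter> S)) * ?r ^ (D - Suc (length xs))" by simp
  also have "\<dots> \<le> real (card S) * ?r ^ (D - Suc (length xs))"
    using assms by (intro mult_right_mono) (auto simp: trap_ratio_def intro!: card_mono)
  also have "real (card S) = 9 / 10 * real n * ?r"
    using assms by (simp add: trap_ratio_def)
  also have "9 / 10 * real n * ?r * ?r ^ (D - Suc (length xs)) = 9 / 10 * real n * trap_factor n D S xs"
    using True pw by (simp add: trap_factor_def)
  also have "\<dots> \<le> real (card C) * trap_factor n D S xs"
    using assms trap_factor_nonneg by (intro mult_right_mono) auto
  finally show ?thesis .
next
  case False
  then have "trap_factor n D S (w # xs) = 0" for w by (auto simp: trap_factor_def)
  then show ?thesis using trap_factor_nonneg by simp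
qed

text \<open>
The method of conditional expectations: averaged over all candidates \<open>w\<close>, the potential does not
grow, so it does not grow for some candidate.
\<close>
lemma trap_potential_choice:
  assumes C: "finite C" "9 * n \<le> 10 * card C" and n: "0 < n" and len: "length (g v) < D"
  shows "\<exists>w\<in>C. trap_potential n k D (g(v := w # g v)) \<le> trap_potential n k D g"
proof (rule ccontr)
  assume no: "\<not> ?thesis"
  have "C \<noteq> {}" using C n by auto
  then have "(\<Sum>w\<in>C. trap_potential n k D g) < (\<Sum>w\<in>C. trap_potential n k D (g(v := w # g v)))"
    using no C by (intro sum_strict_mono) auto
  also have "\<dots> = (\<Sum>(A, S)\<in>tight_covers n k. \<Sum>w\<in>C. \<Prod>u\<in>A. trap_factor n D S ((g(v := w # g v)) u))"
    unfolding trap_potential_def case_prod_unfold by (rule sum.swap)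
  also have "\<dots> \<le> (\<Sum>(A, S)\<in>tight_covers n k. real (card C) * (\<Prod>u\<in>A. trap_factor n D S (g u)))"
  proof (intro sum_mono, clarify)
    fix A S assume "(A, S) \<in> tight_covers n k"
    then have fin: "finite A" "finite S" by (auto simp: tight_covers_def intro: finite_subset)
    show "(\<Sum>w\<in>C. \<Prod>u\<in>A. trap_factor n D S ((g(v := w # g v)) u))
        \<le> real (card C) * (\<Prod>u\<in>A. trap_factor n D S (g u))"
    proof (cases "v \<in> A")
      case True
      let ?p = "\<Prod>u\<in>A - {v}. trap_factor n D S (g u)"
      have "(\<Prod>u\<in>A. trap_factor n D S ((g(v := w # g v)) u)) = trap_factor n D S (w # g v) * ?p" for w
        by (subst prod.remove[OF fin(1) True]) (auto intro!: prod.cong)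
      then have "(\<Sum>w\<in>C. \<Prod>u\<in>A. trap_factor n D S ((g(v := w # g v)) u))
          = (\<Sum>w\<in>C. trap_factor n D S (w # g v)) * ?p"
        by (simp add: sum_distrib_right)
      also have "\<dots> \<le> real (card C) * trap_factor n D S (g v) * ?p"
        using trap_factor_average[OF C n len fin(2)] trap_factor_nonneg
        by (intro mult_right_mono prod_nonneg) auto
      also have "\<dots> = real (card C) * (\<Prod>u\<in>A. trap_factor n D S (g u))"
        by (subst prod.remove[OF fin(1) True]) simp
      finally show ?thesis .
    next
      case False
      then have "(\<Prod>u\<in>A. trap_factor n D S ((g(v := w # g v)) u)) = (\<Prod>u\<in>A. trap_factor n D S (g u))" for w
        by (intro prod.cong) auto
      then show ?thesis by simp
    qed
  qed
  also have "\<dots> = (\<Sum>w\<in>C. trap_potential n k D g)"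
    by (simp add: trap_potential_def sum_distrib_left case_prod_unfold)
  finally show False by simp
qed

text \<open>
When all selections are made, each summand of the potential is 1 or 0, according to whether the pair
violates expansion. A potential below 1 therefore excludes violations.
\<close>
lemma trap_potential_expander:
  assumes pot: "trap_potential n k D g < 1"
    and g: "\<And>v. v < n \<Longrightarrow> length (g v) = D" "\<And>v w. v < n \<Longrightarrow> w \<in> set (g v) \<Longrightarrow> {v, w} \<in> E"
    and E: "\<Union>E \<subseteq> {..<n}" and k: "3 * k \<le> n"
  shows "expander {..<n} k E"
  unfolding expander_def
proof (intro allI impI, rule ccontr)
  fix A assume A: "A \<subseteq> {..<n}" "A \<noteq> {} \<and> card A \<le> k"
    and not: "\<not> 3 * card A < card (A \<union> neighbours E A)"
  have finA: "finite A" using A finite_subset by blast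
  have "A \<union> neighbours E A \<subseteq> {..<n}" using A E by (auto simp: neighbours_def)
  then obtain S where S: "A \<union> neighbours E A \<subseteq> S" "S \<subseteq> {..<n}" "card S = 3 * card A"
    using exists_subset_between[of "A \<union> neighbours E A" "3 * card A" "{..<n}"] not A k by auto
  have AS: "(A, S) \<in> tight_covers n k"
    using S A finA by (auto simp: tight_covers_def Suc_le_eq card_gt_0_iff)
  have "trap_factor n D S (g v) = 1" if "v \<in> A" for v
  proof -
    have "v < n" using that A by auto
    then have "set (g v) \<subseteq> neighbours E A" "length (g v) = D"
      using g that by (auto simp: neighbours_def)
    then show ?thesis using S by (auto simp: trap_factor_def)
  qed
  then have "1 = (\<Prod>v\<in>A. trap_factor n D S (g v))" by simp
  also have "\<dots> \<le> trap_potential n k D g"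
    unfolding trap_potential_def
    using member_le_sum[OF AS, of "\<lambda>(A, S). \<Prod>v\<in>A. trap_factor n D S (g v)"]
    by (auto simp: finite_tight_covers case_prod_unfold intro!: prod_nonneg trap_factor_nonneg)
  finally show False using pot by simp
qed

text \<open>
The exponential series of \<open>m\<close> is at least its term with index \<open>m\<close>.
\<close>
lemma power_self_le_fact: "real m ^ m \<le> 3 ^ m * fact m"
proof -
  have "real m ^ m / fact m \<le> exp (real m)"
  proof -
    have "(\<Sum>i\<in>{m}. real m ^ i /\<^sub>R fact i) \<le> (\<Sum>i. real m ^ i /\<^sub>R fact i)"
      by (intro sum_le_suminf summable_exp_generic) auto
    then show ?thesis by (simp add: exp_def field_simps)
  qed
  also have "exp (real m) = exp 1 ^ m" by (simp add: exp_of_nat_mult[symmetric])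
  also have "\<dots> \<le> 3 ^ m" using exp_le by (intro power_mono) auto
  finally show ?thesis by (simp add: field_simps)
qed

text \<open>
The summand of the union bound for covers \<open>S\<close> of size \<open>m\<close>: there are at most \<open>n choose m\<close> choices of
\<open>S\<close> and \<open>2 ^ m\<close> choices of \<open>A\<close> inside it, and \<open>m / 3\<close> vertices with 30 selections each have to be
trapped. With \<open>y = m / n\<close> the estimate \<open>(n choose m) y ^ m \<le> 3 ^ m\<close> consumes one of the ten powers of
\<open>y\<close>. As \<open>m\<close> slightly exceeds \<open>n / 2\<close> in the worst case, the trapping probability is at most \<open>3 / 5\<close>,
and the other nine powers beat the constants. This fixes the number 30.
\<close>
lemma tight_cover_weight:
  assumes "0 < n" "100 * m \<le> 54 * n"
  shows "real (n choose m) * 2 ^ m * (10 * real m / (9 * real n)) ^ (10 * m) \<le> (1 / 8) ^ m"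
proof -
  let ?y = "real m / real n"
  have "real (n choose m) * real m ^ m \<le> real (n choose m) * (3 ^ m * fact m)"
    by (intro mult_left_mono power_self_le_fact) auto
  also have "\<dots> = 3 ^ m * real ((n choose m) * fact m)" by simp
  also have "\<dots> \<le> 3 ^ m * real (n ^ m)"
    by (intro mult_left_mono, subst of_nat_le_iff, rule binomial_fact_pow) simp
  finally have "real (n choose m) * ?y ^ m \<le> 3 ^ m"
    using assms by (simp add: power_divide field_simps)
  moreover have y: "0 \<le> 10 / 9 * ?y" "10 / 9 * ?y \<le> 3 / 5"
    using assms by (auto simp: field_simps)
  ultimately have "(real (n choose m) * ?y ^ m) * (20 / 9 * (10 / 9 * ?y) ^ 9) ^ m
      \<le> 3 ^ m * (20 / 9 * (3 / 5) ^ 9) ^ m"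
    by (intro mult_mono power_mono mult_nonneg_nonneg zero_le_power) auto
  also have "\<dots> = (3 * (20 / 9 * (3 / 5) ^ 9)) ^ m" by (rule power_mult_distrib[symmetric])
  also have "\<dots> \<le> (1 / 8) ^ m" by (intro power_mono) (auto simp: power_divide)
  also have "(real (n choose m) * ?y ^ m) * (20 / 9 * (10 / 9 * ?y) ^ 9) ^ m =
      real (n choose m) * (?y * (20 / 9 * (10 / 9 * ?y) ^ 9)) ^ m"
    by (simp only: power_mult_distrib mult.assoc)
  also have "?y * (20 / 9 * (10 / 9 * ?y) ^ 9) = 2 * (10 / 9 * ?y) ^ 10"
    by (simp add: eval_nat_numeral)
  also have "(2 * (10 / 9 * ?y) ^ 10) ^ m = 2 ^ m * (10 / 9 * ?y) ^ (10 * m)"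
    by (simp only: power_mult_distrib power_mult)
  finally show ?thesis by (simp add: mult.assoc)
qed

lemma trap_potential_initial:
  assumes n: "0 < n" and k: "300 * k \<le> 54 * n"
  shows "trap_potential n k 30 (\<lambda>_. []) < 1"
proof -
  let ?T = "tight_covers n k"
  let ?c = "\<lambda>a. (10 * real (3 * a) / (9 * real n)) ^ (30 * a)"
  have "trap_potential n k 30 (\<lambda>_. []) = (\<Sum>(A, S)\<in>?T. ?c (card A))"
    unfolding trap_potential_def
    by (intro sum.cong)
      (auto simp: tight_covers_def trap_factor_def trap_ratio_def power_mult[symmetric])
  also have "\<dots> = (\<Sum>a\<in>{1..k}. \<Sum>x\<in>{x\<in>?T. card (fst x) = a}. ?c (card (fst x)))"
    unfolding case_prod_unfold
  proof (rule sum.group[symmetric])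
    show "(\<lambda>x. card (fst x)) ` ?T \<subseteq> {1..k}" by (auto simp: tight_covers_def)
  qed (auto intro: finite_tight_covers)
  also have "\<dots> = (\<Sum>a\<in>{1..k}. real (card {x\<in>?T. card (fst x) = a}) * ?c a)"
    by (intro sum.cong) auto
  also have "\<dots> \<le> (\<Sum>a\<in>{1..k}. (1 / 2) ^ a)"
  proof (intro sum_mono)
    fix a assume a: "a \<in> {1..k}"
    let ?Sg = "SIGMA S : nsets {..<n} (3 * a). Pow S"
    have "card {x\<in>?T. card (fst x) = a} \<le> card ?Sg"
    proof (rule card_inj_on_le[of prod.swap])
      show "finite ?Sg"
        by (intro finite_SigmaI finite_imp_finite_nsets) (auto simp: nsets_def)
      show "prod.swap ` {x\<in>?T. card (fst x) = a} \<subseteq> ?Sg"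
        by (auto simp: tight_covers_def nsets_def dest: finite_subset[OF _ finite_lessThan])
    qed auto
    also have "card ?Sg = (\<Sum>S\<in>nsets {..<n} (3 * a). card (Pow S))"
      by (rule card_SigmaI) (auto simp: finite_imp_finite_nsets nsets_def)
    also have "\<dots> = (\<Sum>S\<in>nsets {..<n} (3 * a). 2 ^ (3 * a))"
      by (intro sum.cong) (auto simp: nsets_def card_Pow)
    also have "\<dots> = (n choose (3 * a)) * 2 ^ (3 * a)" by simp
    finally have "real (card {x\<in>?T. card (fst x) = a}) \<le> real ((n choose (3 * a)) * 2 ^ (3 * a))"
      by (subst of_nat_le_iff)
    then have "real (card {x\<in>?T. card (fst x) = a}) * ?c a
        \<le> real ((n choose (3 * a)) * 2 ^ (3 * a)) * ?c a"
      by (intro mult_right_mono) auto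
    also have "\<dots> = real (n choose (3 * a)) * 2 ^ (3 * a) * (10 * real (3 * a) / (9 * real n)) ^ (10 * (3 * a))"
      by simp
    also have "\<dots> \<le> (1 / 8) ^ (3 * a)"
      by (rule tight_cover_weight) (use n k a in auto)
    also have "\<dots> \<le> (1 / 2) ^ a"
      unfolding power_mult by (intro power_mono) (auto simp: power_divide)
    finally show "real (card {x\<in>?T. card (fst x) = a}) * ?c a \<le> (1 / 2) ^ a" .
  qed
  also have "\<dots> = 1 - (1 / 2) ^ k" by (induction k) (auto simp: field_simps)
  also have "\<dots> < 1" by simp
  finally show ?thesis .
qed

section \<open>Keeping Breaker's degrees small\<close>

definition degree_in :: "edge set \<Rightarrow> nat \<Rightarrow> nat" where
  "degree_in B v = card {e \<in> B. v \<in> e}"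

lemma degree_in_Un_le: "degree_in (B \<union> F) v \<le> degree_in B v + degree_in F v"
proof -
  have "{e \<in> B \<union> F. v \<in> e} = {e \<in> B. v \<in> e} \<union> {e \<in> F. v \<in> e}" by auto
  then show ?thesis unfolding degree_in_def by (metis card_Un_le)
qed

lemma degree_in_le_card: "finite F \<Longrightarrow> degree_in F v \<le> card F"
  unfolding degree_in_def by (intro card_mono) auto

lemma card_neighbours_le_degree:
  assumes "finite B"
  shows "finite {w. {v, w} \<in> B}" "card {w. {v, w} \<in> B} \<le> degree_in B v"
proof -
  have inj: "inj_on (\<lambda>w. {v, w}) {w. {v, w} \<in> B}"
    by (auto simp: inj_on_def doubleton_eq_iff)
  have sub: "(\<lambda>w. {v, w}) ` {w. {v, w} \<in> B} \<subseteq> {e \<in> B. v \<in> e}" by auto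
  show "finite {w. {v, w} \<in> B}" using inj_on_finite[OF inj sub] assms by simp
  show "card {w. {v, w} \<in> B} \<le> degree_in B v"
    unfolding degree_in_def using card_inj_on_le[OF inj sub] assms by simp
qed

lemma finite_complete_edges: "finite (complete_edges n)"
  by (simp add: complete_edges_def finite_imp_finite_nsets)

lemma handshake:
  assumes "F \<subseteq> complete_edges n"
  shows "(\<Sum>v<n. degree_in F v) = 2 * card F"
proof -
  have fin: "finite F" using assms finite_complete_edges finite_subset by blast
  have "degree_in F v = (\<Sum>e\<in>F. if v \<in> e then 1 else 0)" for v
    unfolding degree_in_def card_eq_sum using fin by (rule sum.inter_filter)
  then have "(\<Sum>v<n. degree_in F v) = (\<Sum>v<n. \<Sum>e\<in>F. if v \<in> e then 1 else 0)" by simp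
  also have "\<dots> = (\<Sum>e\<in>F. \<Sum>v<n. if v \<in> e then 1 else 0)" by (rule sum.swap)
  also have "\<dots> = (\<Sum>e\<in>F. 2)"
  proof (rule sum.cong[OF refl])
    fix e assume "e \<in> F"
    then have "e \<subseteq> {..<n}" "card e = 2" using assms by (auto simp: complete_edges_def nsets_def)
    then show "(\<Sum>v<n. if v \<in> e then 1 else 0) = (2::nat)"
      by (simp add: sum.If_cases Int_absorb1)
  qed
  finally show ?thesis by simp
qed

text \<open>
The base is chosen such that the \<open>2 b\<close> degree increments of one Breaker move raise the total danger
by at most half of the largest danger, which is what Walker gains by halving that one.
\<close>
definition danger :: "nat \<Rightarrow> edge set \<Rightarrow> (nat \<Rightarrow> nat list) \<Rightarrow> nat \<Rightarrow> real" where
  "danger b B g v = (1 + 1 / (8 * real b)) ^ degree_in B v * (1 / 2) ^ length (g v)"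

definition unfinished :: "nat \<Rightarrow> nat \<Rightarrow> (nat \<Rightarrow> nat list) \<Rightarrow> nat set" where
  "unfinished n D g = {v. v < n \<and> length (g v) < D}"

lemma danger_nonneg: "0 \<le> danger b B g v"
  by (simp add: danger_def)

lemma finite_unfinished: "finite (unfinished n D g)"
  by (simp add: unfinished_def)

text \<open>
An increase of the degree of \<open>v\<close> by \<open>d \<le> b\<close> multiplies its danger by at most
\<open>exp (d / (8 b)) \<le> 1 + d / (4 b)\<close>, and the increments \<open>d\<close> add up to at most \<open>2 b\<close>.
\<close>
lemma danger_after_breaker:
  assumes b: "0 < b" and F: "F \<subseteq> complete_edges n" "card F \<le> b"
    and M: "\<And>v. v \<in> unfinished n D g \<Longrightarrow> danger b B g v \<le> M" "0 \<le> M"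
  shows "(\<Sum>v\<in>unfinished n D g. danger b (B \<union> F) g v)
          \<le> (\<Sum>v\<in>unfinished n D g. danger b B g v) + M / 2"
proof -
  let ?U = "unfinished n D g" and ?x = "1 / (8 * real b)"
  have finF: "finite F" using F finite_complete_edges finite_subset by blast
  have step: "danger b (B \<union> F) g v \<le> danger b B g v + M * (degree_in F v / (4 * b))"
    if v: "v \<in> ?U" for v
  proof -
    have "(1 + ?x) ^ degree_in F v \<le> exp ?x ^ degree_in F v"
      by (intro power_mono exp_ge_add_one_self) auto
    also have "\<dots> = exp (degree_in F v * ?x)" by (simp only: exp_of_nat_mult)
    also have "\<dots> \<le> 1 + 2 * (degree_in F v * ?x)"
    proof (rule real_exp_bound_lemma)
      have "real (degree_in F v) \<le> b" using degree_in_le_card[OF finF, of v] F by linarith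
      then show "degree_in F v * ?x \<le> 1 / 2" using b by (simp add: field_simps)
    qed simp
    finally have gain: "(1 + ?x) ^ degree_in F v \<le> 1 + degree_in F v / (4 * b)" by simp
    have "(1 + ?x) ^ degree_in (B \<union> F) v \<le> (1 + ?x) ^ (degree_in B v + degree_in F v)"
      using degree_in_Un_le by (intro power_increasing) auto
    then have "danger b (B \<union> F) g v \<le> danger b B g v * (1 + ?x) ^ degree_in F v"
      unfolding danger_def by (simp add: power_add mult.commute mult.left_commute mult_left_mono)
    also have "\<dots> \<le> danger b B g v * (1 + degree_in F v / (4 * b))"
      by (intro mult_left_mono gain danger_nonneg)
    also have "\<dots> = danger b B g v + danger b B g v * (degree_in F v / (4 * b))"
      by (simp add: algebra_simps)
    also have "\<dots> \<le> danger b B g v + M * (degree_in F v / (4 * b))"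
      by (intro add_left_mono mult_right_mono M v) auto
    finally show ?thesis .
  qed
  have "(\<Sum>v\<in>?U. danger b (B \<union> F) g v)
      \<le> (\<Sum>v\<in>?U. danger b B g v + M * (degree_in F v / (4 * b)))"
    by (intro sum_mono step)
  also have "\<dots> = (\<Sum>v\<in>?U. danger b B g v) + M / (4 * b) * (\<Sum>v\<in>?U. degree_in F v)"
    by (simp add: sum.distrib sum_distrib_left)
  also have "(\<Sum>v\<in>?U. degree_in F v) \<le> (\<Sum>v<n. degree_in F v)"
    by (intro sum_mono2) (auto simp: unfinished_def)
  then have "M / (4 * b) * (\<Sum>v\<in>?U. degree_in F v) \<le> M / (4 * b) * real (2 * b)"
    using F(2) M(2) by (intro mult_left_mono, subst of_nat_le_iff) (auto simp: handshake[OF F(1)])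
  also have "M / (4 * b) * real (2 * b) = M / 2" using b by (simp add: field_simps)
  finally show ?thesis by simp
qed

lemma danger_after_walker:
  assumes v: "v \<in> unfinished n D g"
  shows "(\<Sum>u\<in>unfinished n D (g(v := w # g v)). danger b B (g(v := w # g v)) u) + danger b B g v / 2
          \<le> (\<Sum>u\<in>unfinished n D g. danger b B g u)"
    and "u \<in> unfinished n D (g(v := w # g v)) \<Longrightarrow>
          u \<in> unfinished n D g \<and> danger b B (g(v := w # g v)) u \<le> danger b B g u"
proof -
  let ?g = "g(v := w # g v)" and ?U = "unfinished n D g"
  have sub: "unfinished n D ?g \<subseteq> ?U" by (auto simp: unfinished_def split: if_splits)
  have v2: "danger b B ?g v = danger b B g v / 2" by (simp add: danger_def)
  have other: "danger b B ?g u = danger b B g u" if "u \<noteq> v" for u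
    using that by (simp add: danger_def)
  have "(\<Sum>u\<in>unfinished n D ?g. danger b B ?g u) \<le> (\<Sum>u\<in>?U. danger b B ?g u)"
    by (intro sum_mono2 sub finite_unfinished danger_nonneg)
  also have "\<dots> = danger b B g v / 2 + (\<Sum>u\<in>?U - {v}. danger b B g u)"
    by (subst sum.remove[OF finite_unfinished v]) (simp add: v2 other)
  also have "\<dots> = (\<Sum>u\<in>?U. danger b B g u) - danger b B g v / 2"
    using sum.remove[OF finite_unfinished v, of "danger b B g"] by simp
  finally show "(\<Sum>u\<in>unfinished n D ?g. danger b B ?g u) + danger b B g v / 2
      \<le> (\<Sum>u\<in>?U. danger b B g u)" by simp
  show "u \<in> ?U \<and> danger b B ?g u \<le> danger b B g u" if "u \<in> unfinished n D ?g"
    using that sub v2 other[of u] danger_nonneg[of b B g v] by (cases "u = v") auto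
qed

text \<open>
A single danger is at most the total, and the halvings cost at most a factor \<open>2 ^ D\<close>. Taking
logarithms, the degree is \<open>O(b ln n)\<close> when \<open>K\<close> is about \<open>n\<close>; this is where the bias \<open>n / ln n\<close> comes
from.
\<close>
lemma danger_bounds_degree:
  assumes b: "0 < b" and v: "v \<in> unfinished n D g"
    and total: "(\<Sum>u\<in>unfinished n D g. danger b B g u) \<le> K"
  shows "real (degree_in B v) \<le> 9 * real b * (ln K + real D)"
proof -
  let ?x = "1 / (8 * real b)" and ?d = "degree_in B v"
  have "danger b B g v \<le> K"
    using member_le_sum[OF v, of "danger b B g"] total by (simp add: danger_nonneg finite_unfinished)
  moreover have "(1 / 2) ^ D \<le> (1 / 2 :: real) ^ length (g v)"
    using v by (intro power_decreasing) (auto simp: unfinished_def)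
  then have "(1 + ?x) ^ ?d * (1 / 2) ^ D \<le> danger b B g v"
    unfolding danger_def by (intro mult_left_mono) auto
  ultimately have "(1 + ?x) ^ ?d * (1 / 2) ^ D \<le> K" by linarith
  then have le: "(1 + ?x) ^ ?d \<le> K * 2 ^ D" by (simp add: power_divide field_simps)
  have pos: "0 < (1 + ?x) ^ ?d" by (intro zero_less_power add_pos_nonneg) auto
  with le have "0 < K * 2 ^ D" by linarith
  then have K: "0 < K" by (simp add: zero_less_mult_iff)
  have "ln ((1 + ?x) ^ ?d) \<le> ln (K * 2 ^ D)" using le pos K by (subst ln_le_cancel_iff) auto
  then have "?d * ln (1 + ?x) \<le> ln K + D * ln 2"
    using K by (simp add: ln_mult ln_realpow add_pos_nonneg)
  also have "D * ln 2 \<le> D * (1 :: real)"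
    using ln_2_less_1 by (intro mult_left_mono) auto
  finally have *: "?d * ln (1 + ?x) \<le> ln K + D" by simp
  have "1 / (9 * real b) \<le> ?x / (1 + ?x)" using b by (simp add: field_simps)
  also have "\<dots> \<le> ln (1 + ?x)"
  proof -
    have "ln (1 / (1 + ?x)) \<le> 1 / (1 + ?x) - 1" by (rule ln_le_minus_one) (auto simp: add_pos_nonneg)
    moreover have "ln (1 / (1 + ?x)) = - ln (1 + ?x)" by (simp add: ln_div add_pos_nonneg)
    moreover have "1 / (1 + ?x) - 1 = - (?x / (1 + ?x))" using b by (simp add: field_simps)
    ultimately show ?thesis by linarith
  qed
  finally have "?d * (1 / (9 * real b)) \<le> ?d * ln (1 + ?x)" by (intro mult_left_mono) auto
  with * have "?d / (9 * real b) \<le> ln K + D" by simp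
  then show ?thesis using b by (simp add: field_simps)
qed

text \<open>
Vertices that Breaker has used too much can simply be avoided, because the handshake lemma leaves
room for few of them.
\<close>
lemma few_high_degrees:
  assumes "B \<subseteq> complete_edges n"
  shows "n * card {v. v < n \<and> n < 40 * degree_in B v} \<le> 80 * card B"
proof -
  let ?H = "{v. v < n \<and> n < 40 * degree_in B v}"
  have "n * card ?H = (\<Sum>v\<in>?H. n)" by simp
  also have "\<dots> \<le> (\<Sum>v\<in>?H. 40 * degree_in B v)" by (intro sum_mono) auto
  also have "\<dots> \<le> (\<Sum>v<n. 40 * degree_in B v)" by (intro sum_mono2) auto
  also have "\<dots> = 80 * card B" by (simp add: sum_distrib_left[symmetric] handshake[OF assms])
  finally show ?thesis .
qed

section \<open>The game with low bias\<close>

lemma exists_outside: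
  assumes "card X < card R" "finite X"
  shows "\<exists>x\<in>R. x \<notin> X"
  using assms by (meson card_mono leD subsetI)

text \<open>
Before her first move Walker is treated as if she stood at vertex 0, where she will start.
\<close>
definition here :: "game_state \<Rightarrow> nat" where
  "here s = (case position s of None \<Rightarrow> 0 | Some p \<Rightarrow> p)"

text \<open>
All that is used about \<open>n\<close> and \<open>b\<close>. By \<open>b_log\<close>, a total danger of at most \<open>n + 1\<close> keeps the Breaker degrees
of unfinished vertices at or below \<open>n / 40\<close>; by \<open>b_small\<close>, \<open>O(n)\<close> moves of Breaker produce few vertices of high
degree.
\<close>
locale low_bias_game =
  fixes n b :: nat
  assumes b_pos: "0 < b"
    and n_large: "1000000 \<le> n"
    and b_small: "100000 * b \<le> n"
    and b_log: "9 * real b * (ln (real n + 1) + 30) \<le> real n / 40"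
begin

text \<open>
The size up to which sets expand: at least \<open>n / 6\<close> as needed for connectedness, yet small enough
for the union bound.
\<close>
definition k :: nat where "k = n div 6 + 1"

lemma k_bounds: "n \<le> 6 * k" "3 * k \<le> n" "300 * k \<le> 54 * n"
  using n_large by (auto simp: k_def)

text \<open>
The bookkeeping common to both phases, after \<open>t\<close> moves of Walker and \<open>t'\<close> moves of Breaker.
\<close>
definition sound :: "nat \<Rightarrow> nat \<Rightarrow> game_state \<Rightarrow> bool" where
  "sound t t' s \<longleftrightarrow>
     walker_edges s \<subseteq> complete_edges n \<and> breaker_edges s \<subseteq> complete_edges n \<and>
     walker_edges s \<inter> breaker_edges s = {} \<and>
     card (walker_edges s) \<le> 2 * t \<and> card (breaker_edges s) \<le> b * t' \<and> here s < n"

text \<open>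
The first phase, in which each round adds one entry to the lists \<open>g v\<close>.
\<close>
definition scattering :: "nat \<Rightarrow> nat \<Rightarrow> (nat \<Rightarrow> nat list) \<Rightarrow> game_state \<Rightarrow> bool" where
  "scattering t t' g s \<longleftrightarrow> sound t t' s \<and>
     (\<forall>v<n. length (g v) \<le> 30 \<and> (\<forall>w\<in>set (g v). {v, w} \<in> walker_edges s)) \<and>
     t = (\<Sum>v<n. length (g v)) \<and> trap_potential n k 30 g < 1"

text \<open>
The second phase. The path certifies progress: each round increases the length of a longest path,
which bounds the number of rounds.
\<close>
definition closing :: "nat \<Rightarrow> nat \<Rightarrow> game_state \<Rightarrow> bool" where
  "closing t t' s \<longleftrightarrow> sound t t' s \<and> expander {..<n} k (walker_edges s) \<and>
     (\<exists>P. path_in {..<n} (walker_edges s) P \<and> t \<le> 30 * n + length P)"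

text \<open>
Once Walker has a Hamilton cycle, an own edge at her position allows her to wait for the end of the game.
\<close>
definition finished :: "game_state \<Rightarrow> bool" where
  "finished s \<longleftrightarrow>
     walker_edges s \<subseteq> complete_edges n \<and> walker_edges s \<inter> breaker_edges s = {} \<and>
     (\<exists>p q. position s = Some p \<and> {p, q} \<in> walker_edges s) \<and>
     (\<exists>H\<in>hamilton_cycles n. H \<subseteq> walker_edges s)"

text \<open>
\<open>M\<close> is an upper bound for the dangers, and \<open>M / 2\<close> is set aside for the next move of Breaker.
\<close>
definition breaker_to_move :: "game_state \<Rightarrow> bool" where
  "breaker_to_move s \<longleftrightarrow>
     40 * degree_in (breaker_edges s) (here s) \<le> n \<and>
       ((\<exists>t g M. scattering t t g s \<and> 0 \<le> M \<and>
           (\<forall>v\<in>unfinished n 30 g. danger b (breaker_edges s) g v \<le> M) \<and>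
           (\<Sum>v\<in>unfinished n 30 g. danger b (breaker_edges s) g v) + M / 2 \<le> real n + 1)
        \<or> (\<exists>t. closing t t s))
     \<or> finished s"

definition walker_to_move :: "game_state \<Rightarrow> bool" where
  "walker_to_move s \<longleftrightarrow>
     40 * degree_in (breaker_edges s) (here s) \<le> n + 40 * b \<and>
       ((\<exists>t g. scattering t (t + 1) g s \<and>
           (\<Sum>v\<in>unfinished n 30 g. danger b (breaker_edges s) g v) \<le> real n + 1)
        \<or> (\<exists>t. closing t (t + 1) s))
     \<or> finished s"

lemma sound_finite: "sound t t' s \<Longrightarrow> finite (walker_edges s) \<and> finite (breaker_edges s)"
  unfolding sound_def using finite_complete_edges finite_subset by metis

lemma legal_breaker_moveD:
  assumes "legal_breaker_move n b s F"
  shows "F \<subseteq> complete_edges n" "F \<inter> walker_edges s = {}" "card F \<le> b" "finite F"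
  using assms finite_complete_edges[of n] finite_subset
  by (auto simp: legal_breaker_move_def unclaimed_def)

lemma sound_breaker_move:
  assumes s: "sound t t' s" and F: "legal_breaker_move n b s F"
  shows "sound t (t' + 1) (apply_breaker_move F s)"
proof -
  have "card (breaker_edges s \<union> F) \<le> card (breaker_edges s) + card F" by (rule card_Un_le)
  also have "\<dots> \<le> b * (t' + 1)" using s legal_breaker_moveD[OF F] by (simp add: sound_def)
  finally show ?thesis
    using s legal_breaker_moveD[OF F]
    by (auto simp: sound_def apply_breaker_move_def here_def)
qed

lemma sound_walker_move:
  assumes s: "sound t t' s"
    and m: "{here s, v} \<in> complete_edges n - breaker_edges s" "{v, w} \<in> complete_edges n - breaker_edges s"
  shows "legal_walker_move n s (here s, v, w)"
    "sound (t + 1) t' (apply_walker_move (here s, v, w) s)"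
proof -
  show "legal_walker_move n s (here s, v, w)"
    using s m by (auto simp: sound_def here_def walkable_def split: option.splits)
  have "card (walker_edges s \<union> {{here s, v}, {v, w}})
      \<le> card (walker_edges s) + card {{here s, v}, {v, w}}" by (rule card_Un_le)
  also have "card {{here s, v}, {v, w}} \<le> 2" by (simp add: card_insert_if)
  finally have "card (walker_edges s \<union> {{here s, v}, {v, w}}) \<le> 2 * (t + 1)"
    using s by (simp add: sound_def)
  moreover have "w < n" using m by (auto simp: complete_edges_def)
  ultimately show "sound (t + 1) t' (apply_walker_move (here s, v, w) s)"
    using s m by (auto simp: sound_def here_def)
qed

text \<open>
In \<open>O(n)\<close> rounds only \<open>O(n b)\<close> edges are claimed, so neither phase is cut short by the end of the game.
\<close>
lemma sound_not_game_over:
  assumes s: "sound t t' s" and t: "t \<le> 31 * n" "t' \<le> 32 * n"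
  shows "\<not> game_over n s"
proof
  assume "game_over n s"
  then have "complete_edges n \<subseteq> walker_edges s \<union> breaker_edges s"
    by (auto simp: game_over_def unclaimed_def)
  then have "card (complete_edges n) \<le> card (walker_edges s \<union> breaker_edges s)"
    using sound_finite[OF s] by (intro card_mono) auto
  also have "\<dots> \<le> card (walker_edges s) + card (breaker_edges s)" by (rule card_Un_le)
  also have "\<dots> \<le> 2 * t + b * t'" using s by (simp add: sound_def)
  also have "\<dots> \<le> 2 * (31 * n) + b * (32 * n)" using t by (intro add_mono mult_left_mono) auto
  finally have "2 * (n choose 2) \<le> n * (124 + 64 * b)"
    by (simp add: complete_edges_def algebra_simps)
  moreover have "2 * (n choose 2) = n * (n - 1)" unfolding choose_two by (cases "even n") auto
  ultimately have "n - 1 \<le> 124 + 64 * b" using n_large by simp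
  then show False using n_large b_small by linarith
qed

lemma scattering_rounds:
  assumes "scattering t t' g s"
  shows "t \<le> 30 * n"
proof -
  have "(\<Sum>v<n. length (g v)) \<le> (\<Sum>v<n. 30)"
    using assms by (intro sum_mono) (auto simp: scattering_def)
  then show ?thesis using assms by (simp add: scattering_def)
qed

lemma closing_rounds:
  assumes "closing t t' s"
  shows "t \<le> 31 * n"
proof -
  obtain P where "path_in {..<n} (walker_edges s) P" "t \<le> 30 * n + length P"
    using assms by (auto simp: closing_def)
  moreover from this have "length P \<le> n"
    using card_mono[of "{..<n}" "set P"] by (auto simp: path_in_def distinct_card)
  ultimately show ?thesis by simp
qed

lemma phase_not_game_over:
  assumes phase: "scattering t t' g s \<or> closing t t' s" and t': "t' \<le> t + 1"
  shows "\<not> game_over n s"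
proof (rule sound_not_game_over)
  show "sound t t' s" using phase by (auto simp: scattering_def closing_def)
  show "t \<le> 31 * n" using phase scattering_rounds closing_rounds by fastforce
  then show "t' \<le> 32 * n" using t' n_large by simp
qed

lemma initially_breaker_to_move: "breaker_to_move initial_state"
proof -
  have "scattering 0 0 (\<lambda>_. []) initial_state"
    using n_large trap_potential_initial[of n k] k_bounds
    by (simp add: scattering_def sound_def initial_state_def here_def)
  moreover have "danger b {} (\<lambda>_. []) v = 1" for v by (simp add: danger_def degree_in_def)
  moreover have "unfinished n 30 (\<lambda>_. []) = {..<n}" by (auto simp: unfinished_def)
  ultimately show ?thesis
    unfolding breaker_to_move_def
    by (intro disjI1 conjI exI[of _ 0] exI[of _ "\<lambda>_. []"] exI[of _ 1])
      (auto simp: initial_state_def degree_in_def)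
qed

lemma breaker_move_keeps_invariant:
  assumes s: "breaker_to_move s" and F: "legal_breaker_move n b s F"
  shows "walker_to_move (apply_breaker_move F s)"
proof (cases "finished s")
  case True
  then show ?thesis
    using legal_breaker_moveD[OF F]
    by (auto simp: walker_to_move_def finished_def apply_breaker_move_def)
next
  case False
  let ?s = "apply_breaker_move F s"
  have upd: "walker_edges ?s = walker_edges s" "breaker_edges ?s = breaker_edges s \<union> F"
    "here ?s = here s"
    by (auto simp: apply_breaker_move_def here_def)
  have "degree_in (breaker_edges ?s) (here ?s) \<le> degree_in (breaker_edges s) (here s) + b"
    using degree_in_Un_le[of "breaker_edges s" F "here s"]
      degree_in_le_card[OF legal_breaker_moveD(4)[OF F], of "here s"] legal_breaker_moveD(3)[OF F]
    by (simp add: upd)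
  then have deg: "40 * degree_in (breaker_edges ?s) (here ?s) \<le> n + 40 * b"
    using s False by (simp add: breaker_to_move_def)
  consider (scattering) t g M where "scattering t t g s" "0 \<le> M"
      "\<And>v. v \<in> unfinished n 30 g \<Longrightarrow> danger b (breaker_edges s) g v \<le> M"
      "(\<Sum>v\<in>unfinished n 30 g. danger b (breaker_edges s) g v) + M / 2 \<le> real n + 1"
    | (closing) t where "closing t t s"
    using s False unfolding breaker_to_move_def by blast
  then show ?thesis
  proof cases
    case scattering
    have "scattering t (t + 1) g ?s"
      using scattering(1) sound_breaker_move[OF _ F] by (auto simp: scattering_def upd)
    moreover have "(\<Sum>v\<in>unfinished n 30 g. danger b (breaker_edges ?s) g v) \<le> real n + 1"
      unfolding upd
      by (rule order_trans[OF danger_after_breaker[OF b_pos legal_breaker_moveD(1,3)[OF F]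
            scattering(3) scattering(2)] scattering(4)])
    ultimately show ?thesis using deg unfolding walker_to_move_def by blast
  next
    case closing
    then have "closing t (t + 1) ?s"
      using sound_breaker_move[OF _ F] by (auto simp: closing_def upd)
    then show ?thesis using deg unfolding walker_to_move_def by blast
  qed
qed

lemma scattering_complete:
  assumes "scattering t t' g s" "unfinished n 30 g = {}"
  shows "closing t t' s"
proof -
  have len: "length (g v) = 30" if "v < n" for v
    using assms that by (fastforce simp: scattering_def unfinished_def)
  have W: "walker_edges s \<subseteq> complete_edges n" using assms by (simp add: scattering_def sound_def)
  have "expander {..<n} k (walker_edges s)"
  proof (rule trap_potential_expander)
    show "trap_potential n k 30 g < 1" using assms by (simp add: scattering_def)
    show "\<Union> (walker_edges s) \<subseteq> {..<n}" using W by (auto simp: complete_edges_def nsets_def)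
  qed (use assms len k_bounds in \<open>auto simp: scattering_def\<close>)
  moreover have "path_in {..<n} (walker_edges s) [0]" using n_large by (simp add: path_in_def)
  moreover have "t \<le> 30 * n + length [0::nat]" using scattering_rounds[OF assms(1)] by simp
  ultimately show ?thesis using assms(1) unfolding closing_def scattering_def by blast
qed

text \<open>
Walker ends her move at the most endangered vertex \<open>v\<close>, so the next round starts at a
vertex whose Breaker degree was under control. The intermediate vertex \<open>w\<close> is only passed through,
so that it merely has to avoid the Breaker edges at both ends of the move.
\<close>
lemma scattering_move:
  assumes s: "scattering t (t + 1) g s"
    and pos: "40 * degree_in (breaker_edges s) (here s) \<le> n + 40 * b"
    and total: "(\<Sum>v\<in>unfinished n 30 g. danger b (breaker_edges s) g v) \<le> real n + 1"
    and ne: "unfinished n 30 g \<noteq> {}"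
  shows "\<exists>m. legal_walker_move n s m \<and> breaker_to_move (apply_walker_move m s)"
proof -
  let ?B = "breaker_edges s" and ?U = "unfinished n 30 g"
  have so: "sound t (t + 1) s" using s unfolding scattering_def by blast
  have finB: "finite ?B" using sound_finite[OF so] by blast
  have "Max (danger b ?B g ` ?U) \<in> danger b ?B g ` ?U"
    using ne by (intro Max_in) (auto simp: finite_unfinished)
  then obtain v where v: "v \<in> ?U" "danger b ?B g v = Max (danger b ?B g ` ?U)" by force
  have max: "danger b ?B g u \<le> danger b ?B g v" if "u \<in> ?U" for u
    using that v(2) by (simp add: finite_unfinished)
  have "real (degree_in ?B v) \<le> 9 * real b * (ln (real n + 1) + real 30)"
    by (rule danger_bounds_degree[OF b_pos v(1) total])
  then have degv: "40 * degree_in ?B v \<le> n" using b_log by simp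
  define C where "C = {..<n} - ({here s, v} \<union> {w. {here s, w} \<in> ?B} \<union> {w. {v, w} \<in> ?B})"
  have "n - card ({here s, v} \<union> {w. {here s, w} \<in> ?B} \<union> {w. {v, w} \<in> ?B}) \<le> card C"
    unfolding C_def
    using diff_card_le_card_Diff[of "{here s, v} \<union> {w. {here s, w} \<in> ?B} \<union> {w. {v, w} \<in> ?B}" "{..<n}"]
    by (simp add: card_neighbours_le_degree(1)[OF finB])
  moreover have "card ({here s, v} \<union> {w. {here s, w} \<in> ?B} \<union> {w. {v, w} \<in> ?B})
      \<le> 2 + degree_in ?B (here s) + degree_in ?B v"
    using card_neighbours_le_degree(2)[OF finB]
    by (intro order_trans[OF card_Un_le] add_mono) (auto simp: card_insert_if)
  ultimately have "9 * n \<le> 10 * card C" using pos degv b_small n_large by linarith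
  moreover have "finite C" by (simp add: C_def)
  moreover have lenv: "v < n" "length (g v) < 30" using v by (auto simp: unfinished_def)
  ultimately obtain w where w: "w \<in> C"
      "trap_potential n k 30 (g(v := w # g v)) \<le> trap_potential n k 30 g"
    using trap_potential_choice[of C n g v 30 k] n_large by auto
  let ?g = "g(v := w # g v)" and ?m = "(here s, w, v)"
  let ?s = "apply_walker_move ?m s"
  have edges: "{here s, w} \<in> complete_edges n - ?B" "{w, v} \<in> complete_edges n - ?B"
    using w(1) so lenv by (auto simp: C_def sound_def complete_edges_def insert_commute)
  have upd: "walker_edges ?s = walker_edges s \<union> {{here s, w}, {w, v}}" "breaker_edges ?s = ?B"
      "here ?s = v"
    by (auto simp: here_def)
  have "(\<Sum>u<n. length (?g u)) = (\<Sum>u<n. length (g u) + (if u = v then 1 else 0))"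
    by (intro sum.cong) auto
  also have "\<dots> = t + 1" using lenv s by (simp add: sum.distrib scattering_def)
  finally have "t + 1 = (\<Sum>u<n. length (?g u))" by simp
  then have "scattering (t + 1) (t + 1) ?g ?s"
    using s w lenv sound_walker_move(2)[OF so edges]
    unfolding scattering_def upd by (auto simp: insert_commute)
  moreover have "0 \<le> danger b ?B g v" by (rule danger_nonneg)
  moreover have "\<forall>u\<in>unfinished n 30 ?g. danger b ?B ?g u \<le> danger b ?B g v"
    using danger_after_walker(2)[OF v(1)] max by (meson order_trans)
  moreover have "(\<Sum>u\<in>unfinished n 30 ?g. danger b ?B ?g u) + danger b ?B g v / 2 \<le> real n + 1"
    using danger_after_walker(1)[OF v(1), where w = w and b = b and B = ?B] total by linarith
  ultimately have "\<exists>t g M. scattering t t g ?s \<and> 0 \<le> M \<and>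
      (\<forall>u\<in>unfinished n 30 g. danger b ?B g u \<le> M) \<and>
      (\<Sum>u\<in>unfinished n 30 g. danger b ?B g u) + M / 2 \<le> real n + 1"
    by (intro exI[of _ "t + 1"] exI[of _ ?g] exI[of _ "danger b ?B g v"] conjI)
  then have "breaker_to_move ?s" using degv unfolding breaker_to_move_def upd by (intro disjI1 conjI)
  then show ?thesis using sound_walker_move(1)[OF so edges] by blast
qed

text \<open>
Two applications of Posa's lemma yield first the end vertex \<open>x\<close> and then, with \<open>x\<close> fixed as the
first vertex of the path, the end vertex \<open>y\<close>. Both are taken outside the set \<open>H\<close> of vertices
of high Breaker degree: \<open>x\<close> so that few candidates for \<open>y\<close> are blocked, and \<open>y\<close> because the next
move starts there.
\<close>
lemma closing_move:
  assumes s: "closing t (t + 1) s"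
    and pos: "40 * degree_in (breaker_edges s) (here s) \<le> n + 40 * b"
  shows "\<exists>m. legal_walker_move n s m \<and> breaker_to_move (apply_walker_move m s)"
proof -
  let ?B = "breaker_edges s" and ?W = "walker_edges s" and ?V = "{..<n}"
  have so: "sound t (t + 1) s" and ex: "expander ?V k ?W" using s by (auto simp: closing_def)
  have finB: "finite ?B" using sound_finite[OF so] by blast
  have W: "\<Union>?W \<subseteq> ?V" using so by (auto simp: sound_def complete_edges_def nsets_def)
  obtain P where P: "longest_path ?V ?W P" "t \<le> 30 * n + length P"
    using s longest_path_exists[of ?V ?W] by (fastforce simp: closing_def)
  have path: "path_in ?V ?W P" using P by (simp add: longest_path_def)
  define H where "H = {v. v < n \<and> n < 40 * degree_in ?B v}"
  have finH: "finite H" by (simp add: H_def)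
  have "n * card H \<le> 80 * card ?B"
    unfolding H_def by (rule few_high_degrees) (use so in \<open>simp add: sound_def\<close>)
  also have "\<dots> \<le> 80 * (b * (t + 1))" using so by (simp add: sound_def)
  also have "\<dots> \<le> 80 * (b * (32 * n))"
    using closing_rounds[OF s] n_large by (intro mult_left_mono) auto
  finally have "n * card H \<le> n * (2560 * b)" by (simp add: algebra_simps)
  then have H: "card H \<le> 2560 * b" using n_large by simp
  \<comment> \<open>Among more than \<open>k\<close> vertices one is of low Breaker degree and reachable from \<open>p\<close> in one step:
    \<open>H\<close> and the Breaker edges at \<open>p\<close> exclude only about \<open>n / 20\<close> vertices, while \<open>k\<close> is about \<open>n / 6\<close>.\<close>
  have select: "\<exists>x\<in>R. x \<notin> H \<and> x \<noteq> p \<and> {p, x} \<notin> ?B"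
    if "k < card R" "40 * degree_in ?B p \<le> n + 40 * b" for R p
  proof -
    let ?X = "H \<union> {p} \<union> {x. {p, x} \<in> ?B}"
    have "card ?X \<le> card H + 1 + degree_in ?B p"
      using card_neighbours_le_degree(2)[OF finB]
      by (intro order_trans[OF card_Un_le] add_mono) (auto simp: card_insert_if finH)
    also have "\<dots> < k"
    proof -
      have "40 * (card H + 1 + degree_in ?B p) \<le> 102440 * b + n + 40" using H that(2) by simp
      also have "\<dots> < 40 * k" using b_small n_large k_bounds(1) by simp
      finally show ?thesis by simp
    qed
    finally have "card ?X < card R" using that(1) by simp
    then show ?thesis
      using exists_outside[of ?X R] finH card_neighbours_le_degree(1)[OF finB] by auto
  qed
  obtain x where x: "x \<in> rotation_ends ?W P" "x \<notin> H" "x \<noteq> here s" "{here s, x} \<notin> ?B"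
    using select[OF posa_rotation[OF P(1) _ W ex] pos] by auto
  then obtain Q where Q: "rotation ?W P Q" "last Q = x" by (auto simp: rotation_ends_def)
  note Q' = rotation_path[OF Q(1) path]
  have rQ: "path_in ?V ?W (rev Q)" using Q'(1) by (auto simp: path_in_def path_edges_rev)
  then have lrQ: "longest_path ?V ?W (rev Q)" using P(1) Q'(3) by (simp add: longest_path_def)
  have "x < n" using Q' Q(2) by (auto simp: path_in_def)
  then have degx: "40 * degree_in ?B x \<le> n + 40 * b" using x(2) by (simp add: H_def)
  obtain y where y: "y \<in> rotation_ends ?W (rev Q)" "y \<notin> H" "y \<noteq> x" "{x, y} \<notin> ?B"
    using select[OF posa_rotation[OF lrQ _ W ex] degx] by auto
  then obtain R where R: "rotation ?W (rev Q) R" "last R = y" by (auto simp: rotation_ends_def)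
  note R' = rotation_path[OF R(1) rQ]
  have hdR: "hd R = x" using R'(4) Q(2) Q'(1) by (simp add: hd_rev path_in_def)
  have lenR: "length R = length P" using R'(3) Q'(3) by simp
  have "y < n" using R' R(2) by (auto simp: path_in_def)
  let ?s = "apply_walker_move (here s, x, y) s"
  have edges: "{here s, x} \<in> complete_edges n - ?B" "{x, y} \<in> complete_edges n - ?B"
    using x y \<open>x < n\<close> \<open>y < n\<close> so by (auto simp: sound_def complete_edges_def)
  note legal = sound_walker_move(1)[OF so edges] and so' = sound_walker_move(2)[OF so edges]
  have upd: "walker_edges ?s = ?W \<union> {{here s, x}, {x, y}}" "breaker_edges ?s = ?B"
      "here ?s = y" "position ?s = Some y"
    by (auto simp: here_def)
  have W': "\<Union>(walker_edges ?s) \<subseteq> ?V"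
    using so' by (auto simp: sound_def complete_edges_def nsets_def)
  have ex': "expander ?V k (walker_edges ?s)"
    by (rule expander_mono[OF ex _ _ W']) (auto simp: upd)
  have pR: "path_in ?V (walker_edges ?s) R" using R'(1) by (auto simp: path_in_def upd)
  have closure: "{last R, hd R} \<in> walker_edges ?s" using hdR R(2) by (auto simp: upd)
  have "breaker_to_move ?s"
  proof (cases "set R = ?V")
    case True
    then have "length R = n" using pR by (metis card_lessThan distinct_card path_in_def)
    then have "cycle_edges R \<in> hamilton_cycles n"
      using True pR n_large unfolding hamilton_cycles_def path_in_def by auto
    moreover have "cycle_edges R \<subseteq> walker_edges ?s"
      using pR closure by (intro cycle_edges_subset) (auto simp: path_in_def)
    moreover have "{y, x} \<in> walker_edges ?s" by (auto simp: upd)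
    ultimately have "finished ?s"
      using so' upd(4) unfolding finished_def sound_def by blast
    then show ?thesis by (simp add: breaker_to_move_def)
  next
    case False
    have "set R \<subseteq> ?V" "set R \<noteq> {}" using pR by (auto simp: path_in_def)
    then obtain u c where uc: "u \<in> ?V - set R" "c \<in> set R" "{u, c} \<in> walker_edges ?s"
      using expander_connected[OF ex' _ W', of "set R"] False k_bounds(1) by auto
    obtain S where "path_in ?V (walker_edges ?s) S" "length S = Suc (length R)"
      using rotated_cycle_extends[OF pR closure uc(2,1,3)] by blast
    then have "closing (t + 1) (t + 1) ?s"
      unfolding closing_def using so' ex' P(2) lenR by (intro conjI exI[of _ S]) auto
    moreover have "40 * degree_in ?B y \<le> n" using y(2) \<open>y < n\<close> by (simp add: H_def)
    ultimately show ?thesis unfolding breaker_to_move_def upd by blast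
  qed
  then show ?thesis using legal by blast
qed

lemma finished_move:
  assumes "finished s"
  shows "\<exists>m. legal_walker_move n s m \<and> breaker_to_move (apply_walker_move m s)"
proof -
  obtain p q where pq: "position s = Some p" "{p, q} \<in> walker_edges s"
    using assms by (auto simp: finished_def)
  have "legal_walker_move n s (p, q, p)"
    using pq assms by (auto simp: walkable_def finished_def insert_commute)
  moreover have "finished (apply_walker_move (p, q, p) s)"
    using pq assms by (auto simp: finished_def insert_commute insert_absorb)
  ultimately show ?thesis unfolding breaker_to_move_def by blast
qed

theorem walker_wins: "\<exists>\<sigma>. walker_winning_strategy n b (hamilton_cycles n) \<sigma>"
proof (rule winning_strategy_from_invariant[of breaker_to_move n b walker_to_move])
  show "breaker_to_move initial_state" by (rule initially_breaker_to_move)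
next
  fix s F assume "breaker_to_move s" "legal_breaker_move n b s F"
  then show "walker_to_move (apply_breaker_move F s)" by (rule breaker_move_keeps_invariant)
next
  fix s assume s: "walker_to_move s"
  show "\<exists>m. legal_walker_move n s m \<and> breaker_to_move (apply_walker_move m s)"
  proof (cases "finished s")
    case True
    then show ?thesis by (rule finished_move)
  next
    case False
    then have pos: "40 * degree_in (breaker_edges s) (here s) \<le> n + 40 * b"
      and phase: "(\<exists>t g. scattering t (t + 1) g s \<and>
           (\<Sum>v\<in>unfinished n 30 g. danger b (breaker_edges s) g v) \<le> real n + 1)
        \<or> (\<exists>t. closing t (t + 1) s)"
      using s by (simp_all add: walker_to_move_def)
    from phase show ?thesis
    proof (elim disjE exE conjE)
      fix t g assume sc: "scattering t (t + 1) g s"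
        and total: "(\<Sum>v\<in>unfinished n 30 g. danger b (breaker_edges s) g v) \<le> real n + 1"
      show ?thesis
      proof (cases "unfinished n 30 g = {}")
        case True
        show ?thesis by (rule closing_move[OF scattering_complete[OF sc True] pos])
      next
        case False
        show ?thesis by (rule scattering_move[OF sc pos total False])
      qed
    next
      fix t assume "closing t (t + 1) s"
      then show ?thesis using pos by (rule closing_move)
    qed
  qed
next
  fix s assume s: "breaker_to_move s" "game_over n s"
  have "finished s"
  proof (rule ccontr)
    assume "\<not> finished s"
    then obtain t g where "scattering t t g s \<or> closing t t s"
      using s(1) unfolding breaker_to_move_def by blast
    then have "\<not> game_over n s" by (rule phase_not_game_over) simp
    then show False using s(2) by contradiction
  qed
  then show "\<exists>H\<in>hamilton_cycles n. H \<subseteq> walker_edges s" by (simp add: finished_def)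
next
  fix s assume s: "walker_to_move s" "game_over n s"
  have "finished s"
  proof (rule ccontr)
    assume "\<not> finished s"
    then obtain t g where "scattering t (t + 1) g s \<or> closing t (t + 1) s"
      using s(1) unfolding walker_to_move_def by blast
    then have "\<not> game_over n s" by (rule phase_not_game_over) simp
    then show False using s(2) by contradiction
  qed
  then show "\<exists>H\<in>hamilton_cycles n. H \<subseteq> walker_edges s" by (simp add: finished_def)
qed

end

text \<open>
The lower bound \<open>exp 100\<close> for \<open>n\<close> makes \<open>ln n\<close> exceed the additive constants, so that
\<open>9 b (ln (n + 1) + 30) \<le> 18 b ln n\<close>, which is at most \<open>n / 40\<close> for \<open>\<alpha> = 1 / 1000\<close>.
\<close>
lemma low_bias_gameI:
  assumes n: "exp 100 \<le> real n" "1000000 \<le> n" and b: "0 < b" "real b \<le> 1 / 1000 * (real n / ln (real n))"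
  shows "low_bias_game n b"
proof
  have pos: "0 < real n" using n by simp
  have L: "100 \<le> ln (real n)" using n pos by (simp add: ln_ge_iff)
  have bL: "1000 * (real b * ln (real n)) \<le> real n" using b L by (simp add: field_simps)
  have "real b * 100 \<le> real b * ln (real n)" using L by (intro mult_left_mono) auto
  with bL have "real (100000 * b) \<le> real n" by simp
  then show "100000 * b \<le> n" by (simp only: of_nat_le_iff)
  have "ln (real n + 1) \<le> ln (2 * real n)" using n by (subst ln_le_cancel_iff) auto
  also have "\<dots> = ln 2 + ln (real n)" using pos by (simp add: ln_mult)
  also have "\<dots> \<le> 1 + ln (real n)" using ln_2_less_1 by simp
  finally have "ln (real n + 1) + 30 \<le> 2 * ln (real n)" using L by simp
  then have "9 * real b * (ln (real n + 1) + 30) \<le> 9 * real b * (2 * ln (real n))"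
    by (intro mult_left_mono) auto
  also have "\<dots> \<le> real n / 40" using bL by simp
  finally show "9 * real b * (ln (real n + 1) + 30) \<le> real n / 40" .
qed (use n b in auto)

theorem theorem1p5:
  shows "\<exists>\<alpha>::real. \<alpha> > 0 \<and> (\<exists>n\<^sub>0::nat. \<forall>n::nat. n \<ge> n\<^sub>0 \<longrightarrow>
    (\<forall>b::nat. b > 0 \<and> real b \<le> \<alpha> * (real n / ln (real n)) \<longrightarrow>
      (\<exists>\<sigma>. walker_winning_strategy n b (hamilton_cycles n) \<sigma>)))"
proof (rule exI[of _ "1 / 1000"], intro conjI exI[of _ "max 1000000 (nat \<lceil>exp 100 :: real\<rceil>)"] allI impI)
  fix n b :: nat
  assume n: "max 1000000 (nat \<lceil>exp 100 :: real\<rceil>) \<le> n"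
    and b: "b > 0 \<and> real b \<le> 1 / 1000 * (real n / ln (real n))"
  have "exp 100 \<le> real (nat \<lceil>exp 100 :: real\<rceil>)" by (rule real_nat_ceiling_ge)
  also have "\<dots> \<le> real n" using n by (meson max.boundedE of_nat_mono)
  finally show "\<exists>\<sigma>. walker_winning_strategy n b (hamilton_cycles n) \<sigma>"
    using n b by (intro low_bias_game.walker_wins low_bias_gameI) auto
qed simp

end
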